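(* Let $k$ be a field, $<$ a monomial preorder on $k[X]=k[x_1,\dots,x_n]$, and let $I_1,\dots,I_r$ be ideals in $k[X]$. Then there exists an integral vector $w=(w_1,\dots,w_n)\in\mathbb{Z}^n$ such that $L_<(I_i)=L_{<_w}(I_i)$ for $i=1,\dots,r$.
   Context: For $a\in\mathbb{N}^n$ write $x^a=x_1^{\alpha_1}\cdots x_n^{\alpha_n}$. A weak order on a set is a strict partial order for which incomparability is an equivalence relation. A monomial preorder on $k[X]$ is a weak order $<$ on the monomials such that for all $a,b,c\in\mathbb{N}^n$: $x^a<x^b$ if and only if $x^ax^c<x^bx^c$. For $w\in\mathbb{R}^n$, the weight order $<_w$ is the monomial preorder with $x^a<_wx^b$ iff $w\cdot a<w\cdot b$ (standard scalar product). For $f=\sum c_ax^a\in k[X]$, the leading part $L_<(f)$ is the sum of those terms $c_ax^a$ ($c_a\ne0$) such that no monomial $x^b$ occurring in $f$ satisfies $x^a<x^b$. For a subset $G\subseteq k[X]$, the leading ideal $L_<(G)$ is the ideal of $k[X]$ generated by all $L_<(f)$, $f\in G$. *)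

theory Defs
  imports
    "HOL-Analysis.Analysis"
    "HOL-Library.Poly_Mapping"
begin

text \<open>
  The polynomial ring \<open>k[x\<^sub>1, \<dots>, x\<^sub>n]\<close> is the monoid algebra of \<open>\<nat>\<^sup>n\<close> over \<open>k\<close>: the
  variables are indexed by a finite type \<open>'n\<close>, and a polynomial is the finitely supported
  family of its coefficients, multiplied by convolution.  The monomial \<open>x\<^sup>a\<close> is identified
  with its exponent vector \<open>a\<close>, so the product of monomials is the sum of vectors.
\<close>

type_synonym ('n, 'k) mpoly = "(nat ^ 'n) \<Rightarrow>\<^sub>0 'k"

definition incomparable :: "('a \<Rightarrow> 'a \<Rightarrow> bool) \<Rightarrow> 'a \<Rightarrow> 'a \<Rightarrow> bool" where
  "incomparable lt a b \<longleftrightarrow> \<not> lt a b \<and> \<not> lt b a"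

definition weak_order :: "('a \<Rightarrow> 'a \<Rightarrow> bool) \<Rightarrow> bool" where
  "weak_order lt \<longleftrightarrow> irreflp lt \<and> transp lt \<and> equivp (incomparable lt)"

definition monomial_preorder :: "(nat ^ 'n \<Rightarrow> nat ^ 'n \<Rightarrow> bool) \<Rightarrow> bool" where
  "monomial_preorder lt \<longleftrightarrow>
     weak_order lt \<and> (\<forall>a b c. lt a b \<longleftrightarrow> lt (a + c) (b + c))"

definition weight_less :: "real ^ 'n::finite \<Rightarrow> nat ^ 'n \<Rightarrow> nat ^ 'n \<Rightarrow> bool" where
  "weight_less w a b \<longleftrightarrow> w \<bullet> (\<chi> i. real (a $ i)) < w \<bullet> (\<chi> i. real (b $ i))"

definition leading_part ::
    "(nat ^ 'n \<Rightarrow> nat ^ 'n \<Rightarrow> bool) \<Rightarrow> ('n::finite, 'k::field) mpoly \<Rightarrow> ('n, 'k) mpoly" where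
  "leading_part lt f =
     (\<Sum>a \<in> {a \<in> Poly_Mapping.keys f. \<forall>b \<in> Poly_Mapping.keys f. \<not> lt a b}. Poly_Mapping.single a (Poly_Mapping.lookup f a))"

text \<open>
  The ideals of a commutative ring are its submodules as a module over itself, so the
  library's \<^const>\<open>module.subspace\<close> and \<^const>\<open>module.span\<close>, with
  the ring multiplication as scalar multiplication, are ``is an ideal'' and ``ideal generated by''.
\<close>

abbreviation is_ideal :: "'a::comm_ring_1 set \<Rightarrow> bool" where
  "is_ideal \<equiv> module.subspace times"

abbreviation ideal_generated :: "'a::comm_ring_1 set \<Rightarrow> 'a set" where
  "ideal_generated \<equiv> module.span times"

lemma module_times: "module (times :: 'a::comm_ring_1 \<Rightarrow> 'a \<Rightarrow> 'a)"
  by unfold_locales (simp_all add: algebra_simps)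

lemma is_ideal_iff:
  "is_ideal I \<longleftrightarrow> 0 \<in> I \<and> (\<forall>f\<in>I. \<forall>g\<in>I. f + g \<in> I) \<and> (\<forall>h. \<forall>f\<in>I. h * f \<in> I)"
  by (simp add: module.subspace_def [OF module_times])

lemma ideal_generated_eq_Inter:
  "ideal_generated G = \<Inter> {I. is_ideal I \<and> G \<subseteq> I}"
  by (simp add: module.span_def [OF module_times] hull_def)

definition leading_ideal ::
    "(nat ^ 'n \<Rightarrow> nat ^ 'n \<Rightarrow> bool) \<Rightarrow> ('n::finite, 'k::field) mpoly set \<Rightarrow> ('n, 'k) mpoly set" where
  "leading_ideal lt G = ideal_generated (leading_part lt ` G)"

lemma monomial_preorder_weight_less:
  fixes w :: "real ^ 'n::finite"
  shows "monomial_preorder (weight_less w)"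
proof -
  have "w \<bullet> (\<chi> i. real ((a + c) $ i)) = w \<bullet> (\<chi> i. real (a $ i)) + w \<bullet> (\<chi> i. real (c $ i))"
    for a c :: "nat ^ 'n"
    by (simp add: inner_vec_def sum.distrib algebra_simps)
  moreover have "equivp (incomparable (weight_less w))"
    by (rule equivpI)
      (auto simp: incomparable_def weight_less_def intro!: reflpI sympI transpI)
  moreover have "irreflp (weight_less w)" "transp (weight_less w)"
    by (auto simp: weight_less_def intro!: irreflpI transpI)
  ultimately show ?thesis
    by (simp add: monomial_preorder_def weak_order_def weight_less_def)
qed

end

theory Submission
  imports Defs
begin

text \<open>
  Refine \<open>lt\<close> to a total order by the lexicographic order. Dickson's lemma, applied to the leading
  monomial together with the defect \<open>deg f - deg (lm f)\<close>, gives a finite subset \<open>G\<close> of the ideal by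
  which every element of degree \<open>d\<close> can be reduced to zero within degree \<open>d\<close>, although \<open>lt\<close>
  need not be a well-order; hence the leading parts of \<open>G\<close> generate the leading ideal.
  Choose an integral weight \<open>w\<close> that compares the finitely many monomials occurring in \<open>G\<close> as \<open>lt\<close> does. In
  each degree bound \<open>d\<close> the ideal elements form a finite-dimensional space whose number of leading
  monomials is its dimension, whatever the order; so the monomials coming from \<open>G\<close> still exhaust
  the leading monomials for \<open>w\<close>, and both leading ideals are generated by the same leading parts.
\<close>

section \<open>Integral weights representing a preorder on finitely many monomials\<close>

text \<open>Supplies the new coordinate in the elimination below. The order has no endpoints, which
  settles the cases where \<open>A\<close> or \<open>B\<close> is empty.\<close>

lemma exists_between_finite_sets:
  fixes A B :: "'a::{dense_linorder, no_top, no_bot} set"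
  assumes "finite A" "finite B" and less: "\<And>a b. a \<in> A \<Longrightarrow> b \<in> B \<Longrightarrow> a < b"
  shows "\<exists>t. (\<forall>a\<in>A. a < t) \<and> (\<forall>b\<in>B. t < b)"
proof (cases "A = {}")
  case True
  show ?thesis
  proof (cases "B = {}")
    case False
    then show ?thesis
      using True assms(2) lt_ex[of "Min B"] by auto
  qed (use True in auto)
next
  case A: False
  show ?thesis
  proof (cases "B = {}")
    case True
    then show ?thesis
      using A assms(1) gt_ex[of "Max A"] by auto
  next
    case False
    then have "Max A < Min B"
      using A assms by simp
    then obtain t where "Max A < t" "t < Min B"
      using dense by blast
    then show ?thesis
      using A False assms(1,2) by auto
  qed
qed

section \<open>Total cones of integer vectors and weights representing them\<close>

text \<open>\<open>N\<close> abstracts the exponent differences that a monomial preorder does not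
  regard as negative. A nonzero \<open>u\<close> may lie in \<open>N\<close> together with its
  negative; these are the differences of incomparable monomials.\<close>

locale total_cone =
  fixes N :: "('n::finite \<Rightarrow> int) set"
  assumes total: "u \<in> N \<or> (\<lambda>i. - u i) \<in> N"
    and add: "u \<in> N \<Longrightarrow> v \<in> N \<Longrightarrow> (\<lambda>i. u i + v i) \<in> N"
begin

lemma zero: "(\<lambda>i. 0) \<in> N"
  using total[of "\<lambda>i. 0"] by simp

lemma scale_nat: "u \<in> N \<Longrightarrow> (\<lambda>i. int k * u i) \<in> N"
proof (induction k)
  case (Suc k)
  then show ?case
    using add[of u "\<lambda>i. int k * u i"] by (simp add: algebra_simps)
qed (simp add: zero)

lemma scale: "u \<in> N \<Longrightarrow> 0 \<le> k \<Longrightarrow> (\<lambda>i. k * u i) \<in> N"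
  using scale_nat[of u "nat k"] by simp

text \<open>Saturation of the cone: if \<open>u\<close> were not in \<open>N\<close>, its negative
  would be, and adding \<open>k - 1\<close> copies of it to \<open>k * u\<close> gives back
  \<open>u\<close>.\<close>

lemma scale_iff:
  assumes "0 < k"
  shows "(\<lambda>i. k * u i) \<in> N \<longleftrightarrow> u \<in> N"
proof
  assume ku: "(\<lambda>i. k * u i) \<in> N"
  show "u \<in> N"
  proof (rule ccontr)
    assume "u \<notin> N"
    then have "(\<lambda>i. - u i) \<in> N"
      using total by blast
    then have "(\<lambda>i. (k - 1) * - u i) \<in> N"
      using assms by (intro scale) auto
    from add[OF ku this] \<open>u \<notin> N\<close> show False
      by (simp add: algebra_simps)
  qed
qed (use assms scale in auto)

text \<open>
  Elimination of one coordinate \<open>s\<close>: dividing by \<open>u s\<close>, a vector \<open>u\<close> constrains \<open>w s\<close> by its position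
  relative to the threshold \<open>y u\<close>. The eliminants \<open>v s * u - u s * v\<close> make the thresholds
  of nonnegative vectors lie on the correct side of those of nonpositive ones.
\<close>
lemma exists_rat_weight:
  assumes "finite S" "finite F"
    and "\<And>u i. u \<in> F \<Longrightarrow> i \<notin> S \<Longrightarrow> u i = 0"
    and "\<And>u. u \<in> F \<Longrightarrow> (\<lambda>i. - u i) \<in> F"
  shows "\<exists>w :: 'n \<Rightarrow> rat. \<forall>u\<in>F. u \<in> N \<longleftrightarrow> 0 \<le> (\<Sum>i\<in>S. w i * of_int (u i))"
  using assms
proof (induction S arbitrary: F rule: finite_induct)
  case empty
  have "u \<in> N" if "u \<in> F" for u
  proof -
    have "u = (\<lambda>i. 0)"
      using empty.prems(2)[OF that] by auto
    then show ?thesis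
      using zero by simp
  qed
  then show ?case
    by simp
next
  case (insert s S F)
  define el where "el u v = (\<lambda>i. v s * u i - u s * v i)" for u v :: "'n \<Rightarrow> int"
  \<comment> \<open>Eliminants vanish at \<open>s\<close>, so \<open>F'\<close> is supported on
    \<open>S\<close>. Negation swaps the arguments of \<open>el\<close>, so \<open>F'\<close> stays
    closed under negation.\<close>
  define F' where "F' = {u \<in> F. u s = 0} \<union> (\<lambda>(u, v). el u v) ` (F \<times> F)"
  have "finite F'"
    using insert.prems(1) by (auto simp: F'_def)
  moreover have "u i = 0" if "u \<in> F'" "i \<notin> S" for u i
    using that insert.prems(2)[of _ i]
    by (cases "i = s") (auto simp: F'_def el_def insert.prems(2))
  moreover have "(\<lambda>i. - u i) \<in> F'" if "u \<in> F'" for u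
  proof -
    have "(\<lambda>i. - el a b i) = el b a" for a b
      by (auto simp: el_def)
    then show ?thesis
      using that insert.prems(3) by (auto simp: F'_def)
  qed
  ultimately obtain w :: "'n \<Rightarrow> rat" where
    w: "\<And>u. u \<in> F' \<Longrightarrow> u \<in> N \<longleftrightarrow> 0 \<le> (\<Sum>i\<in>S. w i * of_int (u i))"
    using insert.IH[of F'] by auto
  define x where "x u = (\<Sum>i\<in>S. w i * of_int (u i))" for u
  define y where "y u = - x u / of_int (u s)" for u
  define P where "P = {u \<in> F. 0 < u s}"
  have x_neg: "x (\<lambda>i. - u i) = - x u" for u
    by (simp add: x_def sum_negf)
  have x_el: "x (el u v) = of_int (v s) * x u - of_int (u s) * x v" for u v
    by (simp add: x_def el_def sum_subtractf sum_distrib_left algebra_simps)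
  have thresholds: "el u v \<in> N \<longleftrightarrow> y u \<le> y v" if "u \<in> P" "v \<in> P" for u v
  proof -
    have "el u v \<in> N \<longleftrightarrow> 0 \<le> x (el u v)"
      using w[of "el u v"] that by (auto simp: x_def F'_def P_def)
    also have "\<dots> \<longleftrightarrow> y u \<le> y v"
      using that by (simp add: x_el y_def P_def field_simps)
    finally show ?thesis .
  qed
  have el_N: "el u v \<in> N" if "u \<in> N" "(\<lambda>i. - v i) \<in> N" "u \<in> P" "v \<in> P" for u v
    using add[OF scale[OF that(1), of "v s"] scale[OF that(2), of "u s"]] that(3,4)
    by (simp add: el_def P_def)
  \<comment> \<open>If \<open>u\<close> were in \<open>N\<close>, adding \<open>v s * u\<close> to
    \<open>el v u\<close> would put \<open>u s * v\<close> into \<open>N\<close>, and by saturation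
    also \<open>v\<close>.\<close>
  have strict: "u \<notin> N" if "el v u \<in> N" "v \<notin> N" "u \<in> P" "v \<in> P" for u v
  proof
    assume "u \<in> N"
    from add[OF that(1) scale[OF this, of "v s"]] have "(\<lambda>i. u s * v i) \<in> N"
      using that by (simp add: el_def P_def)
    then show False
      using that scale_iff by (simp add: P_def)
  qed
  have strict': "(\<lambda>i. - v i) \<notin> N" if "el v u \<in> N" "(\<lambda>i. - u i) \<notin> N" "u \<in> P" "v \<in> P" for u v
  proof
    assume "(\<lambda>i. - v i) \<in> N"
    from add[OF that(1) scale[OF this, of "u s"]] have "(\<lambda>i. v s * - u i) \<in> N"
      using that by (simp add: el_def P_def)
    then show False
      using that(2,4) scale_iff[of "v s" "\<lambda>i. - u i"] by (simp add: P_def)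
  qed
  \<comment> \<open>A vector lying in \<open>N\<close> with its negative forces \<open>t\<close> to
    be its threshold; otherwise \<open>t\<close> is placed strictly between the thresholds of
    members and non-members. The second equivalence serves the vectors of \<open>F\<close> with
    negative coordinate \<open>s\<close>, whose negatives lie in \<open>P\<close>.\<close>
  have "\<exists>t. \<forall>u\<in>P. (u \<in> N \<longleftrightarrow> y u \<le> t) \<and> ((\<lambda>i. - u i) \<in> N \<longleftrightarrow> t \<le> y u)"
  proof (cases "\<exists>z\<in>P. z \<in> N \<and> (\<lambda>i. - z i) \<in> N")
    case True
    then obtain z where z: "z \<in> P" "z \<in> N" "(\<lambda>i. - z i) \<in> N"
      by blast
    have "(u \<in> N \<longleftrightarrow> y u \<le> y z) \<and> ((\<lambda>i. - u i) \<in> N \<longleftrightarrow> y z \<le> y u)" if "u \<in> P" for u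
      using el_N[of u z] el_N[of z u] strict[of u z] strict'[of z u] thresholds that z by blast
    then show ?thesis
      by blast
  next
    case False
    have "y u < y v" if "u \<in> P \<inter> N" "v \<in> P - N" for u v
      using strict[of v u] that thresholds[of v u] by auto
    then obtain t where t: "\<forall>a \<in> y ` (P \<inter> N). a < t" "\<forall>b \<in> y ` (P - N). t < b"
      using exists_between_finite_sets[of "y ` (P \<inter> N)" "y ` (P - N)"] insert.prems(1)
      by (auto simp: P_def)
    have "(u \<in> N \<longleftrightarrow> y u \<le> t) \<and> ((\<lambda>i. - u i) \<in> N \<longleftrightarrow> t \<le> y u)" if "u \<in> P" for u
    proof (cases "u \<in> N")
      case True
      then show ?thesis
        using t(1) that False by (force simp: not_le)
    next
      case False
      then show ?thesis
        using t(2) that total[of u] by (force simp: not_le)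
    qed
    then show ?thesis
      by blast
  qed
  then obtain t where t: "\<And>u. u \<in> P \<Longrightarrow> u \<in> N \<longleftrightarrow> y u \<le> t"
    "\<And>u. u \<in> P \<Longrightarrow> (\<lambda>i. - u i) \<in> N \<longleftrightarrow> t \<le> y u"
    by blast
  have "u \<in> N \<longleftrightarrow> 0 \<le> (\<Sum>i\<in>insert s S. (w(s := t)) i * of_int (u i))" if "u \<in> F" for u
  proof -
    have "(\<Sum>i\<in>S. (w(s := t)) i * of_int (u i)) = x u"
      unfolding x_def using insert.hyps by (intro sum.cong) auto
    then have sum: "(\<Sum>i\<in>insert s S. (w(s := t)) i * of_int (u i)) = t * of_int (u s) + x u"
      using insert.hyps by simp
    consider "u s = 0" | "0 < u s" | "u s < 0"
      by linarith
    then show ?thesis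
    proof cases
      case 1
      then show ?thesis
        using w[of u] that sum by (simp add: F'_def x_def)
    next
      case 2
      then have "y u \<le> t \<longleftrightarrow> - x u \<le> t * of_int (u s)"
        unfolding y_def by (subst pos_divide_le_eq) auto
      then have "y u \<le> t \<longleftrightarrow> 0 \<le> t * of_int (u s) + x u"
        by linarith
      then show ?thesis
        using t(1)[of u] sum that 2 by (simp add: P_def)
    next
      case 3
      let ?v = "\<lambda>i. - u i"
      have "?v \<in> P"
        using 3 that insert.prems(3) by (simp add: P_def)
      moreover have "t \<le> y ?v \<longleftrightarrow> t * - of_int (u s) \<le> x u"
        unfolding y_def using 3 by (subst pos_le_divide_eq) (auto simp: x_neg)
      then have "t \<le> y ?v \<longleftrightarrow> 0 \<le> t * of_int (u s) + x u"
        by linarith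
      ultimately show ?thesis
        using t(2)[of ?v] sum by simp
    qed
  qed
  then show ?case
    by blast
qed

end

lemma common_denominator:
  fixes w :: "'a \<Rightarrow> rat"
  assumes "finite S"
  shows "\<exists>D>0. \<forall>i\<in>S. \<exists>z. of_int D * w i = of_int z"
  using assms
proof (induction S rule: finite_induct)
  case (insert s S)
  then obtain D where D: "D > 0" "\<And>i. i \<in> S \<Longrightarrow> \<exists>z. of_int D * w i = of_int z"
    by blast
  obtain p q where pq: "q > 0" "w s = of_int p / of_int q"
    using quotient_of_div quotient_of_denom_pos by (cases "quotient_of (w s)") blast
  have "\<exists>z. of_int (D * q) * w i = of_int z" if "i \<in> insert s S" for i
  proof (cases "i = s")
    case True
    then show ?thesis
      using pq by (intro exI[of _ "D * p"]) simp
  next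
    case False
    then obtain z where "of_int D * w i = of_int z"
      using D(2)[of i] \<open>i \<in> insert s S\<close> False by auto
    then show ?thesis
      by (intro exI[of _ "q * z"]) (simp add: mult.assoc mult.left_commute)
  qed
  then show ?case
    using D(1) pq(1) by (intro exI[of _ "D * q"]) simp
qed (auto intro: exI[of _ 1])

text \<open>The rational weight is taken for the closure of \<open>F\<close> under negation;
  clearing denominators multiplies it by a positive \<open>D\<close> and keeps all signs.\<close>

lemma (in total_cone) exists_int_weight:
  assumes "finite F"
  shows "\<exists>w :: 'n \<Rightarrow> int. \<forall>u\<in>F. u \<in> N \<longleftrightarrow> 0 \<le> (\<Sum>i\<in>UNIV. w i * u i)"
proof -
  define F' where "F' = F \<union> (\<lambda>u i. - u i) ` F"
  obtain w :: "'n \<Rightarrow> rat" where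
    w: "\<And>u. u \<in> F' \<Longrightarrow> u \<in> N \<longleftrightarrow> 0 \<le> (\<Sum>i\<in>UNIV. w i * of_int (u i))"
    using exists_rat_weight[of UNIV F'] assms by (fastforce simp: F'_def)
  obtain D where "D > 0" "\<forall>i. \<exists>z. of_int D * w i = of_int z"
    using common_denominator[of UNIV w] by auto
  then obtain z where z: "\<And>i. of_int D * w i = of_int (z i)"
    by metis
  have "u \<in> N \<longleftrightarrow> 0 \<le> (\<Sum>i\<in>UNIV. z i * u i)" if "u \<in> F" for u
  proof -
    let ?x = "\<Sum>i\<in>UNIV. w i * of_int (u i)"
    have "of_int D * ?x = of_int (\<Sum>i\<in>UNIV. z i * u i)"
      by (simp add: sum_distrib_left mult.assoc[symmetric] z)
    moreover have "0 \<le> of_int D * ?x \<longleftrightarrow> 0 \<le> ?x"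
      using \<open>D > 0\<close> by (simp add: zero_le_mult_iff)
    ultimately have "0 \<le> ?x \<longleftrightarrow> 0 \<le> (\<Sum>i\<in>UNIV. z i * u i)"
      by (simp only: of_int_0_le_iff)
    then show ?thesis
      using w[of u] that by (simp add: F'_def)
  qed
  then show ?thesis
    by blast
qed

section \<open>From monomial preorders to total cones\<close>

text \<open>If \<open>lt a c\<close> held, transitivity of \<open>lt\<close> would exclude
  \<open>lt b a\<close> and \<open>lt c b\<close>, so \<open>b\<close> would be incomparable to both
  \<open>a\<close> and \<open>c\<close>, and then so would \<open>a\<close> to \<open>c\<close>.
  This makes the cone closed under addition.\<close>

lemma weak_order_not_less_trans:
  assumes "weak_order lt" "\<not> lt a b" "\<not> lt b c"
  shows "\<not> lt a c"
proof
  assume "lt a c"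
  have "transp lt" and "equivp (incomparable lt)"
    using assms(1) by (auto simp: weak_order_def)
  have "\<not> lt b a"
    using transpD[OF \<open>transp lt\<close>, of b a c] \<open>lt a c\<close> assms(3) by blast
  moreover have "\<not> lt c b"
    using transpD[OF \<open>transp lt\<close>, of a c b] \<open>lt a c\<close> assms(2) by blast
  ultimately have "incomparable lt a b" "incomparable lt b c"
    using assms(2,3) by (auto simp: incomparable_def)
  with equivp_transp[OF \<open>equivp (incomparable lt)\<close>] have "incomparable lt a c"
    by blast
  with \<open>lt a c\<close> show False
    by (simp add: incomparable_def)
qed

lemma monomial_preorder_add_cancel:
  assumes "monomial_preorder lt"
  shows "lt (c + a) (c + b) \<longleftrightarrow> lt a b"
  using assms unfolding monomial_preorder_def add.commute[of c] by blast

text \<open>Comparisons depend only on the difference of exponents, so it suffices to represent a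
  total cone on the finitely many differences of elements of \<open>M\<close>.\<close>

lemma monomial_preorder_exists_weight:
  fixes lt :: "nat ^ 'n::finite \<Rightarrow> nat ^ 'n \<Rightarrow> bool"
  assumes lt: "monomial_preorder lt" and "finite M"
  shows "\<exists>w :: int ^ 'n. \<forall>a\<in>M. \<forall>b\<in>M.
           weight_less (\<chi> j. real_of_int (w $ j)) a b \<longleftrightarrow> lt a b"
proof -
  \<comment> \<open>Exponents are natural numbers, so an integer vector is tested through its
    positive and negative parts.\<close>
  define N where "N = {u :: 'n \<Rightarrow> int. \<not> lt (\<chi> i. nat (u i)) (\<chi> i. nat (- u i))}"
  have diff: "(\<lambda>i. int (b $ i) - int (a $ i)) \<in> N \<longleftrightarrow> \<not> lt b a" for a b
  proof -
    \<comment> \<open>Cancelling the greatest common divisor \<open>c\<close> of the two monomials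
      leaves the positive and negative parts of \<open>?u\<close>.\<close>
    define c where "c = (\<chi> i. min (a $ i) (b $ i))"
    let ?u = "\<lambda>i. int (b $ i) - int (a $ i)"
    have "c + (\<chi> i. nat (?u i)) = b" "c + (\<chi> i. nat (- ?u i)) = a"
      unfolding vec_eq_iff c_def vector_add_component vec_lambda_beta by linarith+
    with monomial_preorder_add_cancel[OF lt, of c "\<chi> i. nat (?u i)" "\<chi> i. nat (- ?u i)"]
    show ?thesis
      unfolding N_def by simp
  qed
  interpret total_cone N
  proof
    fix u :: "'n \<Rightarrow> int"
    have "\<not> (lt a b \<and> lt b a)" for a b
      using lt irreflpD[of lt a] transpD[of lt a b a]
      unfolding monomial_preorder_def weak_order_def by blast
    then show "u \<in> N \<or> (\<lambda>i. - u i) \<in> N"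
      by (simp add: N_def)
  next
    fix u v :: "'n \<Rightarrow> int"
    assume uv: "u \<in> N" "v \<in> N"
    define p q where "p u = (\<chi> i. nat (u i))" and "q u = (\<chi> i. nat (- u i))"
      for u :: "'n \<Rightarrow> int"
    \<comment> \<open>The intermediate monomial \<open>p v + q u\<close> replaces \<open>p u\<close>
      by \<open>q u\<close> first; the second comparison then replaces \<open>p v\<close> by
      \<open>q v\<close>.\<close>
    have "\<not> lt (p u + p v) (p v + q u)" "\<not> lt (p v + q u) (q u + q v)"
      using uv monomial_preorder_add_cancel[OF lt, of "p v" "p u" "q u"]
        monomial_preorder_add_cancel[OF lt, of "q u" "p v" "q v"]
      by (simp_all add: N_def p_def q_def add.commute)
    then have "\<not> lt (p u + p v) (q u + q v)"
      using lt weak_order_not_less_trans[of lt "p u + p v" "p v + q u" "q u + q v"]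
      by (simp add: monomial_preorder_def)
    then have "(\<lambda>i. int ((p u + p v) $ i) - int ((q u + q v) $ i)) \<in> N"
      by (simp only: diff not_False_eq_True)
    moreover have "(\<lambda>i. int ((p u + p v) $ i) - int ((q u + q v) $ i)) = (\<lambda>i. u i + v i)"
      by (auto simp: p_def q_def)
    ultimately show "(\<lambda>i. u i + v i) \<in> N"
      by simp
  qed
  obtain w :: "'n \<Rightarrow> int" where
    w: "\<forall>u \<in> (\<lambda>(a, b) i. int (b $ i) - int (a $ i)) ` (M \<times> M).
          u \<in> N \<longleftrightarrow> 0 \<le> (\<Sum>i\<in>UNIV. w i * u i)"
    using exists_int_weight[of "(\<lambda>(a, b) i. int (b $ i) - int (a $ i)) ` (M \<times> M)"] assms(2)
    by auto
  have "weight_less (\<chi> j. real_of_int ((\<chi> i. w i) $ j)) a b \<longleftrightarrow> lt a b"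
    if "a \<in> M" "b \<in> M" for a b
  proof -
    let ?u = "\<lambda>i. int (a $ i) - int (b $ i)"
    have "(\<Sum>i\<in>UNIV. real_of_int (w i) * real (a $ i)) - (\<Sum>i\<in>UNIV. real_of_int (w i) * real (b $ i)) =
      real_of_int (\<Sum>i\<in>UNIV. w i * ?u i)"
      by (simp add: sum_subtractf algebra_simps)
    moreover have "weight_less (\<chi> j. real_of_int ((\<chi> i. w i) $ j)) a b \<longleftrightarrow>
      (\<Sum>i\<in>UNIV. real_of_int (w i) * real (a $ i)) < (\<Sum>i\<in>UNIV. real_of_int (w i) * real (b $ i))"
      by (simp add: weight_less_def inner_vec_def)
    ultimately have "weight_less (\<chi> j. real_of_int ((\<chi> i. w i) $ j)) a b \<longleftrightarrow>
      \<not> 0 \<le> real_of_int (\<Sum>i\<in>UNIV. w i * ?u i)"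
      by linarith
    also have "\<dots> \<longleftrightarrow> ?u \<notin> N"
    proof -
      have "?u \<in> (\<lambda>(a, b) i. int (b $ i) - int (a $ i)) ` (M \<times> M)"
        by (rule image_eqI[of _ _ "(b, a)"]) (use that in auto)
      from bspec[OF w this] show ?thesis
        unfolding of_int_0_le_iff by simp
    qed
    also have "\<dots> \<longleftrightarrow> lt a b"
      using diff[where b = a and a = b] by simp
    finally show ?thesis .
  qed
  then show ?thesis
    by blast
qed

section \<open>Total refinements of monomial preorders\<close>

definition monomial_order :: "(nat ^ 'n \<Rightarrow> nat ^ 'n \<Rightarrow> bool) \<Rightarrow> bool" where
  "monomial_order ord \<longleftrightarrow> monomial_preorder ord \<and> (\<forall>a b. a \<noteq> b \<longrightarrow> ord a b \<or> ord b a)"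

lemma monomial_preorder_irrefl: "monomial_preorder lt \<Longrightarrow> \<not> lt a a"
  unfolding monomial_preorder_def weak_order_def by (blast dest: irreflpD)

lemma monomial_preorder_trans: "monomial_preorder lt \<Longrightarrow> lt a b \<Longrightarrow> lt b c \<Longrightarrow> lt a c"
  unfolding monomial_preorder_def weak_order_def by (blast dest: transpD)

lemma monomial_preorder_incomparable_trans:
  "monomial_preorder lt \<Longrightarrow> incomparable lt a b \<Longrightarrow> incomparable lt b c \<Longrightarrow> incomparable lt a c"
  unfolding monomial_preorder_def weak_order_def by (blast dest: equivp_transp)

lemma incomparable_sym: "incomparable lt a b \<Longrightarrow> incomparable lt b a"
  by (simp add: incomparable_def)

lemma monomial_preorder_less_incomparable:
  assumes "monomial_preorder lt" "lt a b" "incomparable lt b c"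
  shows "lt a c"
proof (rule ccontr)
  assume "\<not> lt a c"
  moreover have "\<not> lt c a"
    using monomial_preorder_trans[OF assms(1), of c a b] assms(2,3)
    by (auto simp: incomparable_def)
  ultimately have "incomparable lt c a"
    by (simp add: incomparable_def)
  then have "incomparable lt b a"
    using monomial_preorder_incomparable_trans[OF assms(1) assms(3)] by blast
  with assms(2) show False
    by (simp add: incomparable_def)
qed

lemma monomial_preorder_incomparable_less:
  assumes "monomial_preorder lt" "incomparable lt a b" "lt b c"
  shows "lt a c"
proof (rule ccontr)
  assume "\<not> lt a c"
  moreover have "\<not> lt c a"
    using monomial_preorder_trans[OF assms(1), of b c a] assms(2,3)
    by (auto simp: incomparable_def)
  ultimately have "incomparable lt a c"
    by (simp add: incomparable_def)
  then have "incomparable lt b c"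
    using monomial_preorder_incomparable_trans[OF assms(1) incomparable_sym[OF assms(2)]] by blast
  with assms(3) show False
    by (simp add: incomparable_def)
qed

lemma monomial_orderI:
  assumes irrefl: "\<And>a. \<not> ord a a" and trans: "\<And>a b c. ord a b \<Longrightarrow> ord b c \<Longrightarrow> ord a c"
    and total: "\<And>a b. a \<noteq> b \<Longrightarrow> ord a b \<or> ord b a"
    and add: "\<And>a b c. ord (a + c) (b + c) \<longleftrightarrow> ord a b"
  shows "monomial_order ord"
proof -
  have "incomparable ord = (=)"
    using irrefl total by (auto simp: incomparable_def fun_eq_iff)
  moreover have "irreflp ord" "transp ord"
    using irrefl trans by (auto intro: irreflpI transpI)
  ultimately show ?thesis
    using total add
    by (simp add: monomial_order_def monomial_preorder_def weak_order_def identity_equivp)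
qed

text \<open>The index type carries no order of its own; the injection \<open>to_nat\<close> ranks
  the variables.\<close>

definition lex_less :: "nat ^ 'n::finite \<Rightarrow> nat ^ 'n \<Rightarrow> bool" where
  "lex_less a b \<longleftrightarrow> (\<exists>j. a $ j < b $ j \<and> (\<forall>i. to_nat i < to_nat j \<longrightarrow> a $ i = b $ i))"

lemma monomial_order_lex_less: "monomial_order (lex_less :: nat ^ 'n::finite \<Rightarrow> _)"
proof (rule monomial_orderI)
  fix a b c :: "nat ^ 'n"
  assume "lex_less a b" "lex_less b c"
  then obtain j k where jk:
    "a $ j < b $ j" "\<And>i. to_nat i < to_nat j \<Longrightarrow> a $ i = b $ i"
    "b $ k < c $ k" "\<And>i. to_nat i < to_nat k \<Longrightarrow> b $ i = c $ i"
    unfolding lex_less_def by blast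
  consider "to_nat j < to_nat k" | "j = k" | "to_nat k < to_nat j"
    using linorder_less_linear[of "to_nat j" "to_nat k"] by auto
  then show "lex_less a c"
  proof cases
    case 1
    then show ?thesis
      unfolding lex_less_def using jk by (intro exI[of _ j]) auto
  next
    case 2
    then show ?thesis
      unfolding lex_less_def using jk by (intro exI[of _ j]) auto
  next
    case 3
    then show ?thesis
      unfolding lex_less_def using jk by (intro exI[of _ k]) auto
  qed
next
  fix a b :: "nat ^ 'n"
  assume "a \<noteq> b"
  then obtain j0 where "a $ j0 \<noteq> b $ j0"
    by (auto simp: vec_eq_iff)
  then obtain j where j: "a $ j \<noteq> b $ j" "\<forall>i. a $ i \<noteq> b $ i \<longrightarrow> to_nat j \<le> to_nat i"
    using ex_has_least_nat[of "\<lambda>j. a $ j \<noteq> b $ j" j0 to_nat] by auto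
  then have "\<forall>i. to_nat i < to_nat j \<longrightarrow> a $ i = b $ i"
    using not_le by blast
  moreover have "a $ j < b $ j \<or> b $ j < a $ j"
    using j(1) by linarith
  ultimately show "lex_less a b \<or> lex_less b a"
    unfolding lex_less_def by (metis (full_types))
qed (auto simp: lex_less_def)

definition tie_break :: "(nat ^ 'n::finite \<Rightarrow> nat ^ 'n \<Rightarrow> bool) \<Rightarrow> nat ^ 'n \<Rightarrow> nat ^ 'n \<Rightarrow> bool" where
  "tie_break lt a b \<longleftrightarrow> lt a b \<or> incomparable lt a b \<and> lex_less a b"

lemma monomial_order_tie_break:
  fixes lt :: "nat ^ 'n::finite \<Rightarrow> nat ^ 'n \<Rightarrow> bool"
  assumes lt: "monomial_preorder lt"
  shows "monomial_order (tie_break lt)"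
proof (rule monomial_orderI)
  have lex: "monomial_preorder (lex_less :: nat ^ 'n \<Rightarrow> _)"
    "a \<noteq> b \<Longrightarrow> lex_less a b \<or> lex_less b a" for a b :: "nat ^ 'n"
    using monomial_order_lex_less by (auto simp: monomial_order_def)
  show "\<not> tie_break lt a a" for a
    using monomial_preorder_irrefl[OF lt] monomial_preorder_irrefl[OF lex(1)]
    by (auto simp: tie_break_def)
  show "tie_break lt a c" if "tie_break lt a b" "tie_break lt b c" for a b c
    using that monomial_preorder_trans[OF lt, of a b c] monomial_preorder_trans[OF lex(1), of a b c]
      monomial_preorder_less_incomparable[OF lt, of a b c]
      monomial_preorder_incomparable_less[OF lt, of a b c]
      monomial_preorder_incomparable_trans[OF lt, of a b c]
    unfolding tie_break_def by blast
  show "tie_break lt a b \<or> tie_break lt b a" if "a \<noteq> b" for a b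
    using lex(2)[OF that] by (auto simp: tie_break_def incomparable_def)
  show "tie_break lt (a + c) (b + c) \<longleftrightarrow> tie_break lt a b" for a b c
    using monomial_preorder_add_cancel[OF lt, of c] monomial_preorder_add_cancel[OF lex(1), of c a b]
    by (simp add: tie_break_def incomparable_def add.commute[of _ c])
qed

lemma monomial_order_asym: "monomial_order ord \<Longrightarrow> ord a b \<Longrightarrow> \<not> ord b a"
  unfolding monomial_order_def
  using monomial_preorder_irrefl[of ord a] monomial_preorder_trans[of ord a b a] by blast

section \<open>Leading monomials and leading parts\<close>

lemma lookup_single_mult_add:
  fixes f :: "'a::cancel_comm_monoid_add \<Rightarrow>\<^sub>0 'k::semiring_0"
  shows "Poly_Mapping.lookup (Poly_Mapping.single c k * f) (c + a) = k * Poly_Mapping.lookup f a"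
  by (simp add: lookup_mult lookup_single when_mult)

lemma keys_single_mult:
  fixes f :: "'a::cancel_comm_monoid_add \<Rightarrow>\<^sub>0 'k::semiring_no_zero_divisors"
  assumes "k \<noteq> 0"
  shows "Poly_Mapping.keys (Poly_Mapping.single c k * f) = (+) c ` Poly_Mapping.keys f"
proof
  show "Poly_Mapping.keys (Poly_Mapping.single c k * f) \<subseteq> (+) c ` Poly_Mapping.keys f"
    using keys_mult[of "Poly_Mapping.single c k" f] assms by auto
  show "(+) c ` Poly_Mapping.keys f \<subseteq> Poly_Mapping.keys (Poly_Mapping.single c k * f)"
    using assms by (auto simp: in_keys_iff lookup_single_mult_add)
qed

text \<open>For fixed \<open>m\<close> this is additive in \<open>f\<close>, whereas the class
  selected by \<open>leading_part\<close> varies with \<open>f\<close>. Here \<open>m\<close> need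
  not occur in \<open>f\<close>, and the result may be zero.\<close>

definition class_part ::
    "(nat ^ 'n \<Rightarrow> nat ^ 'n \<Rightarrow> bool) \<Rightarrow> nat ^ 'n \<Rightarrow> ('n::finite, 'k::field) mpoly \<Rightarrow> ('n, 'k) mpoly" where
  "class_part lt m f =
     (\<Sum>a \<in> {a \<in> Poly_Mapping.keys f. incomparable lt m a}. Poly_Mapping.single a (Poly_Mapping.lookup f a))"

lemma lookup_class_part:
  "Poly_Mapping.lookup (class_part lt m f) b =
     (if incomparable lt m b then Poly_Mapping.lookup f b else 0)"
  by (simp add: class_part_def lookup_sum lookup_single when_def in_keys_iff)

lemma class_part_add: "class_part lt m (f + g) = class_part lt m f + class_part lt m g"
  by (rule poly_mapping_eqI) (simp add: lookup_class_part lookup_add)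

lemma class_part_single_mult:
  assumes "monomial_preorder lt" "k \<noteq> 0"
  shows "class_part lt (c + m) (Poly_Mapping.single c k * f) = Poly_Mapping.single c k * class_part lt m f"
proof (rule poly_mapping_eqI)
  fix b
  show "Poly_Mapping.lookup (class_part lt (c + m) (Poly_Mapping.single c k * f)) b =
    Poly_Mapping.lookup (Poly_Mapping.single c k * class_part lt m f) b"
  proof (cases "b \<in> range ((+) c)")
    case True
    then show ?thesis
      using monomial_preorder_add_cancel[OF assms(1)]
      by (auto simp: lookup_class_part lookup_single_mult_add incomparable_def)
  next
    case False
    then have "Poly_Mapping.lookup (Poly_Mapping.single c k * h) b = 0" for h :: "('a, 'b) mpoly"
      using keys_single_mult[OF assms(2), of c h] by (auto simp: not_in_keys_iff_lookup_eq_zero[symmetric])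
    then show ?thesis
      by (simp add: lookup_class_part)
  qed
qed

text \<open>A relation rather than a function, so that the zero polynomial simply has no leading
  monomial.\<close>

definition leading_monomial ::
    "(nat ^ 'n \<Rightarrow> nat ^ 'n \<Rightarrow> bool) \<Rightarrow> ('n::finite, 'k::field) mpoly \<Rightarrow> nat ^ 'n \<Rightarrow> bool" where
  "leading_monomial ord f m \<longleftrightarrow>
     m \<in> Poly_Mapping.keys f \<and> (\<forall>b\<in>Poly_Mapping.keys f. b \<noteq> m \<longrightarrow> ord b m)"

lemma finite_has_greatest:
  assumes "monomial_order ord" "finite A" "A \<noteq> {}"
  shows "\<exists>m\<in>A. \<forall>b\<in>A. b \<noteq> m \<longrightarrow> ord b m"
proof -
  have "asymp_on A ord" "transp_on A ord"
    using monomial_order_asym[OF assms(1)] assms(1) monomial_preorder_trans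
    unfolding asymp_on_def transp_on_def monomial_order_def by blast+
  from Finite_Set.bex_max_element[OF assms(2) this assms(3)] show ?thesis
    using assms(1) unfolding monomial_order_def by blast
qed

lemma exists_leading_monomial:
  "monomial_order ord \<Longrightarrow> f \<noteq> 0 \<Longrightarrow> \<exists>m. leading_monomial ord f m"
  using finite_has_greatest[of ord "Poly_Mapping.keys f"] by (auto simp: leading_monomial_def)

lemma leading_monomial_unique:
  "monomial_order ord \<Longrightarrow> leading_monomial ord f m \<Longrightarrow> leading_monomial ord f m' \<Longrightarrow> m = m'"
  unfolding leading_monomial_def using monomial_order_asym[of ord m m'] by metis

lemma leading_monomial_single_mult:
  assumes "monomial_order ord" "leading_monomial ord f m" "k \<noteq> 0"
  shows "leading_monomial ord (Poly_Mapping.single c k * f) (c + m)"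
  using assms monomial_preorder_add_cancel[of ord c]
  by (auto simp: leading_monomial_def keys_single_mult monomial_order_def)

lemma cancel_leading_monomial:
  assumes "leading_monomial ord f m" "leading_monomial ord h m"
    and "Poly_Mapping.lookup f m = Poly_Mapping.lookup h m"
    and "b \<in> Poly_Mapping.keys (f - h)"
  shows "ord b m"
proof -
  have "b \<noteq> m"
    using assms(3,4) by (auto simp: in_keys_iff lookup_minus)
  moreover have "b \<in> Poly_Mapping.keys f \<or> b \<in> Poly_Mapping.keys h"
    using assms(4) by (auto simp: in_keys_iff lookup_minus)
  ultimately show ?thesis
    using assms(1,2) by (auto simp: leading_monomial_def)
qed

text \<open>Two maximal monomials are incomparable. Conversely, a monomial incomparable to the
  maximal \<open>m\<close> cannot lie below a monomial of \<open>f\<close>, since \<open>m\<close>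
  would then lie below it too.\<close>

lemma leading_part_eq_class_part:
  assumes lt: "monomial_preorder lt"
    and m: "m \<in> Poly_Mapping.keys f" "\<And>b. b \<in> Poly_Mapping.keys f \<Longrightarrow> \<not> lt m b"
  shows "leading_part lt f = class_part lt m f"
proof -
  have "(\<forall>b\<in>Poly_Mapping.keys f. \<not> lt a b) \<longleftrightarrow> incomparable lt m a"
    if "a \<in> Poly_Mapping.keys f" for a
    using that m monomial_preorder_incomparable_less[OF lt, of m a]
    by (auto simp: incomparable_def)
  then show ?thesis
    unfolding leading_part_def class_part_def by (intro sum.cong) auto
qed

lemma leading_part_zero: "leading_part lt 0 = 0"
  by (simp add: leading_part_def)

text \<open>The order \<open>ord\<close> need not be a well-order; the induction is on a finite set \<open>M\<close> of monomials.\<close>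
lemma leading_monomial_induct:
  fixes V :: "('n::finite, 'k::field) mpoly set"
  assumes ord: "monomial_order ord" and M: "finite M" "\<And>f. f \<in> V \<Longrightarrow> Poly_Mapping.keys f \<subseteq> M"
    and zero: "P 0"
    and step: "\<And>f m. f \<in> V \<Longrightarrow> leading_monomial ord f m \<Longrightarrow>
      (\<And>f'. f' \<in> V \<Longrightarrow> (\<And>b. b \<in> Poly_Mapping.keys f' \<Longrightarrow> ord b m) \<Longrightarrow> P f') \<Longrightarrow> P f"
    and "f \<in> V"
  shows "P f"
proof -
  \<comment> \<open>The part of \<open>M\<close> at or below some monomial of \<open>f\<close>;
    passing to \<open>f'\<close> loses at least \<open>m\<close>.\<close>
  define D where "D f = {b \<in> M. \<exists>a \<in> Poly_Mapping.keys f. b = a \<or> ord b a}"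
    for f :: "('n, 'k) mpoly"
  show ?thesis
    using \<open>f \<in> V\<close>
  proof (induction "card (D f)" arbitrary: f rule: less_induct)
    case less
    show ?case
    proof (cases "f = 0")
      case False
      then obtain m where m: "leading_monomial ord f m"
        using exists_leading_monomial[OF ord] by blast
      show ?thesis
      proof (rule step[OF less.prems m])
        fix f'
        assume f': "f' \<in> V" and below: "\<And>b. b \<in> Poly_Mapping.keys f' \<Longrightarrow> ord b m"
        have "m \<in> D f"
          using m M(2)[OF less.prems] by (auto simp: D_def leading_monomial_def)
        moreover have "m \<notin> D f'"
          using below monomial_order_asym[OF ord] by (auto simp: D_def)
        moreover have "D f' \<subseteq> D f"
        proof
          fix b
          assume "b \<in> D f'"
          then obtain a where "b \<in> M" "a \<in> Poly_Mapping.keys f'" "b = a \<or> ord b a"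
            unfolding D_def by blast
          moreover from this have "ord b m"
            using below[of a] monomial_preorder_trans[of ord b a m] ord
            by (auto simp: monomial_order_def)
          ultimately show "b \<in> D f"
            using m by (auto simp: D_def leading_monomial_def)
        qed
        ultimately have "D f' \<subset> D f"
          by blast
        then have "card (D f') < card (D f)"
          using M(1) by (intro psubset_card_mono) (auto simp: D_def)
        then show "P f'"
          using less.hyps f' by blast
      qed
    qed (use zero in simp)
  qed
qed

section \<open>Dimension count for leading monomials\<close>

text \<open>Scalars act as constant polynomials, \<open>0\<close> being the exponent vector of the
  monomial 1.\<close>

interpretation mpoly: vector_space "\<lambda>(k::'k::field) (f :: ('n::finite, 'k) mpoly). Poly_Mapping.single 0 k * f"
  by unfold_locales (simp_all add: algebra_simps single_add mult_single flip: mult.assoc)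

text \<open>The greatest \<open>m\<close> in \<open>A\<close> occurs in no \<open>b a\<close> with
  \<open>a\<close> another element of \<open>A\<close>. The polynomials without \<open>m\<close>
  form a subspace that contains these \<open>b a\<close> but not \<open>b m\<close>.\<close>

lemma independent_distinct_leading_monomials:
  fixes b :: "nat ^ 'n::finite \<Rightarrow> ('n, 'k::field) mpoly"
  assumes ord: "monomial_order ord" and "finite A"
    and "\<And>m. m \<in> A \<Longrightarrow> leading_monomial ord (b m) m"
  shows "mpoly.independent (b ` A)"
  using assms(2,3)
proof (induction A rule: finite_psubset_induct)
  case (psubset A)
  show ?case
  proof (cases "A = {}")
    case False
    then obtain m where m: "m \<in> A" "\<And>a. a \<in> A \<Longrightarrow> a \<noteq> m \<Longrightarrow> ord a m"
      using finite_has_greatest[OF ord psubset.hyps] by blast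
    have "m \<notin> Poly_Mapping.keys (b a)" if "a \<in> A - {m}" for a
      using that m(2)[of a] psubset.prems[of a] monomial_order_asym[OF ord, of a m]
      by (auto simp: leading_monomial_def)
    then have "Poly_Mapping.lookup (b a) m = 0" if "a \<in> A - {m}" for a
      using that by (simp add: in_keys_iff)
    moreover have "mpoly.subspace {f :: ('n, 'k) mpoly. Poly_Mapping.lookup f m = 0}"
      by (auto simp: mpoly.subspace_def lookup_add lookup_single_mult_add[of 0 _ _ m, simplified])
    ultimately have "mpoly.span (b ` (A - {m})) \<subseteq> {f. Poly_Mapping.lookup f m = 0}"
      by (intro mpoly.span_minimal) auto
    moreover have "Poly_Mapping.lookup (b m) m \<noteq> 0"
      using psubset.prems[OF m(1)] by (auto simp: leading_monomial_def in_keys_iff)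
    ultimately have "b m \<notin> mpoly.span (b ` (A - {m}))"
      by blast
    moreover have "mpoly.independent (b ` (A - {m}))"
      using m(1) psubset.prems by (intro psubset.IH) auto
    ultimately have "mpoly.independent (insert (b m) (b ` (A - {m})))"
      by (rule mpoly.independent_insertI)
    then show ?thesis
      using m(1) by (metis image_insert insert_Diff)
  qed (simp add: mpoly.independent_empty)
qed

text \<open>
  The number of leading monomials of a finite-dimensional space is its dimension, hence the
  same for all orders.
\<close>
lemma leading_monomials_eq_of_subset:
  fixes V :: "('n::finite, 'k::field) mpoly set"
  assumes ord: "monomial_order ord1" "monomial_order ord2"
    and V: "mpoly.subspace V" and M: "finite M" "\<And>f. f \<in> V \<Longrightarrow> Poly_Mapping.keys f \<subseteq> M"
    and sub: "\<And>f m. f \<in> V \<Longrightarrow> leading_monomial ord1 f m \<Longrightarrow> \<exists>g\<in>V. leading_monomial ord2 g m"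
    and f: "f \<in> V" "leading_monomial ord2 f m"
  shows "\<exists>g\<in>V. leading_monomial ord1 g m"
proof -
  define A where "A ord = {m. \<exists>f\<in>V. leading_monomial ord f m}" for ord
  have "A ord \<subseteq> M" for ord
    using M(2) by (auto simp: A_def leading_monomial_def)
  then have fin: "finite (A ord)" for ord
    using M(1) finite_subset by blast
  have "\<exists>b. \<forall>m\<in>A ord. b m \<in> V \<and> leading_monomial ord (b m) m" for ord
    by (rule bchoice) (auto simp: A_def)
  then obtain b where b: "\<And>ord m. m \<in> A ord \<Longrightarrow> b ord m \<in> V"
    "\<And>ord m. m \<in> A ord \<Longrightarrow> leading_monomial ord (b ord m) m"
    by metis
  \<comment> \<open>The chosen elements span \<open>V\<close>: subtracting a scalar multiple of
    \<open>b ord1 m\<close> removes the leading monomial and leaves only smaller ones.\<close>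
  have "g \<in> mpoly.span (b ord1 ` A ord1)" if "g \<in> V" for g
  proof (rule leading_monomial_induct[OF ord(1) M _ _ that])
    show "0 \<in> mpoly.span (b ord1 ` A ord1)"
      by (rule mpoly.span_zero)
    fix g m
    assume g: "g \<in> V" "leading_monomial ord1 g m"
      and IH: "\<And>g'. g' \<in> V \<Longrightarrow> (\<And>b. b \<in> Poly_Mapping.keys g' \<Longrightarrow> ord1 b m) \<Longrightarrow>
        g' \<in> mpoly.span (b ord1 ` A ord1)"
    have "m \<in> A ord1"
      using g by (auto simp: A_def)
    define k where "k = Poly_Mapping.lookup g m / Poly_Mapping.lookup (b ord1 m) m"
    let ?h = "Poly_Mapping.single 0 k * b ord1 m"
    have nz: "Poly_Mapping.lookup g m \<noteq> 0" "Poly_Mapping.lookup (b ord1 m) m \<noteq> 0"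
      using g(2) b(2)[OF \<open>m \<in> A ord1\<close>] by (auto simp: leading_monomial_def in_keys_iff)
    have h: "leading_monomial ord1 ?h m"
      using leading_monomial_single_mult[OF ord(1) b(2)[OF \<open>m \<in> A ord1\<close>], of k 0] nz
      by (simp add: k_def)
    have "Poly_Mapping.lookup ?h m = Poly_Mapping.lookup g m"
      using lookup_single_mult_add[of 0 k "b ord1 m" m] nz by (simp add: k_def)
    then have "\<And>b. b \<in> Poly_Mapping.keys (g - ?h) \<Longrightarrow> ord1 b m"
      using cancel_leading_monomial[OF g(2) h] by simp
    moreover have "g - ?h \<in> V"
      using g(1) b(1)[OF \<open>m \<in> A ord1\<close>] V by (intro mpoly.subspace_diff mpoly.subspace_scale)
    ultimately have "g - ?h \<in> mpoly.span (b ord1 ` A ord1)"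
      using IH by blast
    moreover have "?h \<in> mpoly.span (b ord1 ` A ord1)"
      using \<open>m \<in> A ord1\<close> by (intro mpoly.span_scale mpoly.span_base) auto
    ultimately have "g - ?h + ?h \<in> mpoly.span (b ord1 ` A ord1)"
      by (rule mpoly.span_add)
    then show "g \<in> mpoly.span (b ord1 ` A ord1)"
      by simp
  qed
  \<comment> \<open>An independent family in the span of a finite family is no larger than that
    family, so \<open>A ord2\<close> is no larger than its subset \<open>A ord1\<close>.\<close>
  then have "b ord2 ` A ord2 \<subseteq> mpoly.span (b ord1 ` A ord1)"
    using b(1) by blast
  moreover have "mpoly.independent (b ord2 ` A ord2)"
    using independent_distinct_leading_monomials[OF ord(2) fin b(2)] by blast
  ultimately have "card (b ord2 ` A ord2) \<le> card (b ord1 ` A ord1)"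
    using mpoly.independent_span_bound fin by blast
  also have "\<dots> \<le> card (A ord1)"
    by (rule card_image_le[OF fin])
  also have "card (b ord2 ` A ord2) = card (A ord2)"
  proof (intro card_image inj_onI)
    fix x y
    assume "x \<in> A ord2" "y \<in> A ord2" "b ord2 x = b ord2 y"
    then show "x = y"
      using leading_monomial_unique[OF ord(2), of "b ord2 x" x y] b(2)[of x ord2] b(2)[of y ord2]
      by simp
  qed
  finally have "A ord1 = A ord2"
    using sub fin by (intro card_seteq) (auto simp: A_def)
  then show ?thesis
    using f by (auto simp: A_def)
qed

section \<open>Standard bases\<close>

text \<open>Induction on the coordinates: a finite \<open>F0\<close> that is good for the
  coordinates in \<open>S\<close> also covers every \<open>t\<close> whose coordinate
  \<open>s\<close> is at least the bound \<open>K\<close>, and each of the finitely many layers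
  below \<open>K\<close> has its own finite set. The coordinates are arbitrary functions, so the
  degree defect can be one of them.\<close>

lemma dickson:
  fixes c :: "'s \<Rightarrow> 'b \<Rightarrow> nat"
  assumes "finite S"
  shows "\<exists>F\<subseteq>T. finite F \<and> (\<forall>t\<in>T. \<exists>f\<in>F. \<forall>s\<in>S. c s f \<le> c s t)"
  using assms
proof (induction S arbitrary: T rule: finite_induct)
  case empty
  show ?case
  proof (cases "T = {}")
    case False
    then obtain t where "t \<in> T"
      by blast
    then show ?thesis
      by (intro exI[of _ "{t}"]) auto
  qed auto
next
  case (insert s S)
  obtain F0 where F0: "F0 \<subseteq> T" "finite F0" "\<And>t. t \<in> T \<Longrightarrow> \<exists>f\<in>F0. \<forall>s\<in>S. c s f \<le> c s t"
    using insert.IH[of T] by blast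
  \<comment> \<open>Inserting \<open>0\<close> keeps \<open>Max\<close> meaningful when
    \<open>F0\<close> is empty.\<close>
  define K where "K = Max (insert 0 (c s ` F0))"
  have K: "c s f \<le> K" if "f \<in> F0" for f
    using that F0(2) by (simp add: K_def)
  define layer where "layer k = {t\<in>T. c s t = k}" for k
  define Q where "Q k F \<longleftrightarrow> F \<subseteq> layer k \<and> finite F \<and>
      (\<forall>t\<in>layer k. \<exists>f\<in>F. \<forall>s\<in>S. c s f \<le> c s t)" for k F
  define F where "F k = (SOME F. Q k F)" for k
  have "\<exists>F. Q k F" for k
    using insert.IH[of "layer k"] unfolding Q_def .
  then have "Q k (F k)" for k
    unfolding F_def by (rule someI_ex)
  then have F: "\<And>k. F k \<subseteq> layer k" "\<And>k. finite (F k)"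
    "\<And>k t. t \<in> layer k \<Longrightarrow> \<exists>f\<in>F k. \<forall>s\<in>S. c s f \<le> c s t"
    unfolding Q_def by blast+
  have "\<exists>f\<in>F0 \<union> (\<Union>k<K. F k). \<forall>s\<in>insert s S. c s f \<le> c s t" if "t \<in> T" for t
  proof (cases "c s t < K")
    case True
    obtain f where "f \<in> F (c s t)" "\<forall>s\<in>S. c s f \<le> c s t"
      using F(3)[of t "c s t"] \<open>t \<in> T\<close> by (auto simp: layer_def)
    with True F(1)[of "c s t"] show ?thesis
      by (intro bexI[of _ f]) (auto simp: layer_def)
  next
    case False
    obtain f where "f \<in> F0" "\<forall>s\<in>S. c s f \<le> c s t"
      using F0(3)[OF \<open>t \<in> T\<close>] by blast
    with False K[of f] show ?thesis
      by (intro bexI[of _ f]) auto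
  qed
  with F0(1,2) F(1,2) show ?case
    by (intro exI[of _ "F0 \<union> (\<Union>k<K. F k)"]) (auto simp: layer_def)
qed

definition monomial_degree :: "nat ^ 'n::finite \<Rightarrow> nat" where
  "monomial_degree a = (\<Sum>i\<in>UNIV. a $ i)"

lemma monomial_degree_add: "monomial_degree (a + b) = monomial_degree a + monomial_degree b"
  by (simp add: monomial_degree_def sum.distrib)

lemma finite_monomial_degree_le: "finite {a :: nat ^ 'n::finite. monomial_degree a \<le> d}"
proof (rule finite_subset)
  show "{a :: nat ^ 'n. monomial_degree a \<le> d} \<subseteq> vec_lambda ` (UNIV \<rightarrow>\<^sub>E {..d})"
  proof
    fix a :: "nat ^ 'n"
    assume "a \<in> {a. monomial_degree a \<le> d}"
    moreover have "a $ i \<le> monomial_degree a" for i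
      unfolding monomial_degree_def by (rule member_le_sum) auto
    ultimately have "a $ i \<le> d" for i
      using le_trans by blast
    then show "a \<in> vec_lambda ` (UNIV \<rightarrow>\<^sub>E {..d})"
      by (intro image_eqI[of _ _ "vec_nth a"]) (auto simp: vec_lambda_eta)
  qed
  show "finite (vec_lambda ` ((UNIV :: 'n set) \<rightarrow>\<^sub>E {..d}))"
    by (intro finite_imageI finite_PiE) auto
qed

text \<open>
  In addition to divisibility of the leading monomials, the degree of the multiple of \<open>g\<close> that
  cancels the leading monomial of \<open>f\<close> is at most the degree of \<open>f\<close>, so that reduction takes
  place among finitely many monomials.
\<close>
definition standard_basis ::
    "(nat ^ 'n \<Rightarrow> nat ^ 'n \<Rightarrow> bool) \<Rightarrow> ('n::finite, 'k::field) mpoly set \<Rightarrow> ('n, 'k) mpoly set \<Rightarrow> bool" where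
  "standard_basis ord I G \<longleftrightarrow> G \<subseteq> I \<and>
     (\<forall>f\<in>I. \<forall>m. leading_monomial ord f m \<longrightarrow>
       (\<exists>g\<in>G. \<exists>c m'. leading_monomial ord g m' \<and> m = c + m' \<and>
         (\<forall>a\<in>Poly_Mapping.keys g. \<exists>b\<in>Poly_Mapping.keys f. monomial_degree (c + a) \<le> monomial_degree b)))"

lemma exists_finite_standard_basis:
  fixes I :: "('n::finite, 'k::field) mpoly set"
  assumes ord: "monomial_order ord"
  shows "\<exists>G. finite G \<and> standard_basis ord I G"
proof -
  \<comment> \<open>Both \<open>lm 0\<close> and \<open>deg 0\<close> are unspecified; Dickson's
    lemma is therefore applied to \<open>I - {0}\<close>.\<close>
  define lm where "lm f = (SOME m. leading_monomial ord f m)" for f :: "('n, 'k) mpoly"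
  define deg where "deg f = Max (monomial_degree ` Poly_Mapping.keys f)" for f :: "('n, 'k) mpoly"
  have lm: "leading_monomial ord f (lm f)" if "f \<noteq> 0" for f
    unfolding lm_def using exists_leading_monomial[OF ord that] by (rule someI_ex)
  have deg: "monomial_degree a \<le> deg f" if "a \<in> Poly_Mapping.keys f" for a f
    using that by (simp add: deg_def)
  \<comment> \<open>\<open>None\<close> indexes the defect. The leading monomial of a nonzero
    \<open>f\<close> occurs in \<open>f\<close>, so the subtraction is not truncated there.\<close>
  define c where "c s f = (case s of None \<Rightarrow> deg f - monomial_degree (lm f) | Some j \<Rightarrow> lm f $ j)"
    for s f
  obtain G where G: "G \<subseteq> I - {0}" "finite G" "\<And>f. f \<in> I - {0} \<Longrightarrow> \<exists>g\<in>G. \<forall>s. c s g \<le> c s f"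
    using dickson[of UNIV "I - {0}" c] by auto
  have "standard_basis ord I G"
    unfolding standard_basis_def
  proof (intro conjI ballI allI impI)
    show "G \<subseteq> I"
      using G(1) by blast
    fix f m
    assume f: "f \<in> I" and lm_f: "leading_monomial ord f m"
    have "f \<noteq> 0"
      using lm_f by (auto simp: leading_monomial_def)
    then have m: "m = lm f"
      using leading_monomial_unique[OF ord lm_f] lm by blast
    obtain g where g: "g \<in> G" "\<And>s. c s g \<le> c s f"
      using G(3)[of f] f \<open>f \<noteq> 0\<close> by blast
    have "g \<noteq> 0"
      using g(1) G(1) by blast
    define d where "d = (\<chi> j. lm f $ j - lm g $ j)"
    have d: "lm f = d + lm g"
      using g(2)[of "Some _"] by (simp add: d_def vec_eq_iff c_def)
    have "\<exists>b\<in>Poly_Mapping.keys f. monomial_degree (d + a) \<le> monomial_degree b"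
      if "a \<in> Poly_Mapping.keys g" for a
    proof -
      have "deg f \<in> monomial_degree ` Poly_Mapping.keys f"
        unfolding deg_def using \<open>f \<noteq> 0\<close> by (intro Max_in) auto
      then obtain b where b: "b \<in> Poly_Mapping.keys f" "monomial_degree b = deg f"
        by auto
      have "lm f \<in> Poly_Mapping.keys f"
        using lm[OF \<open>f \<noteq> 0\<close>] by (simp add: leading_monomial_def)
      \<comment> \<open>The degree of \<open>g\<close> is at most that of \<open>lm g\<close> plus
        the defect of \<open>f\<close>, and the degrees of \<open>d\<close> and \<open>lm g\<close>
        add up to that of \<open>lm f\<close>.\<close>
      then have "monomial_degree (d + a) \<le> deg f"
        using g(2)[of None] deg[OF that] deg[of "lm f" f] d
        by (simp add: c_def monomial_degree_add)
      with b show ?thesis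
        by (intro bexI[of _ b]) simp_all
    qed
    then show "\<exists>g\<in>G. \<exists>c m'. leading_monomial ord g m' \<and> m = c + m' \<and>
        (\<forall>a\<in>Poly_Mapping.keys g. \<exists>b\<in>Poly_Mapping.keys f. monomial_degree (c + a) \<le> monomial_degree b)"
      using g(1) lm[OF \<open>g \<noteq> 0\<close>] m d by blast
  qed
  with G(2) show ?thesis
    by blast
qed

lemma is_ideal_subspace:
  fixes I :: "('n::finite, 'k::field) mpoly set"
  assumes "is_ideal I"
  shows "mpoly.subspace {f \<in> I. Poly_Mapping.keys f \<subseteq> M}"
proof -
  have "Poly_Mapping.keys (Poly_Mapping.single 0 k * f) \<subseteq> Poly_Mapping.keys f"
    for k and f :: "('n, 'k) mpoly"
    by (cases "k = 0") (auto simp: keys_single_mult)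
  then show ?thesis
    using assms keys_add[where ?'a = "nat ^ 'n" and ?'b = 'k]
    unfolding is_ideal_iff mpoly.subspace_def by (simp add: subset_iff) blast
qed

text \<open>In a degree truncation of \<open>I\<close>, each leading monomial for
  \<open>ord1\<close> is that of a monomial multiple of some \<open>g\<close>, and this multiple has
  the same leading monomial for \<open>ord2\<close>. The dimension count turns this inclusion into
  an equality. The degree clause keeps the multiples inside the truncation.\<close>

lemma standard_basis_change_order:
  fixes I :: "('n::finite, 'k::field) mpoly set"
  assumes ord: "monomial_order ord1" "monomial_order ord2" and I: "is_ideal I"
    and G: "standard_basis ord1 I G"
    and lm: "\<And>g m. g \<in> G \<Longrightarrow> leading_monomial ord1 g m \<longleftrightarrow> leading_monomial ord2 g m"
  shows "standard_basis ord2 I G"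
  unfolding standard_basis_def
proof (intro conjI ballI allI impI)
  show "G \<subseteq> I"
    using G by (simp add: standard_basis_def)
  fix f m
  assume f: "f \<in> I" "leading_monomial ord2 f m"
  \<comment> \<open>All monomials of degree at most that of \<open>f\<close>, so that
    \<open>V\<close> is a finite-dimensional truncation of \<open>I\<close> containing
    \<open>f\<close>.\<close>
  define M where "M = (\<Union>b\<in>Poly_Mapping.keys f. {a :: nat ^ 'n. monomial_degree a \<le> monomial_degree b})"
  define V where "V = {h \<in> I. Poly_Mapping.keys h \<subseteq> M}"
  have std: "\<exists>g\<in>G. \<exists>c m'. leading_monomial ord2 g m' \<and> m = c + m' \<and>
      (\<forall>a\<in>Poly_Mapping.keys g. c + a \<in> M)"
    if "h \<in> V" "leading_monomial ord1 h m" for h m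
  proof -
    obtain g c m' where g: "g \<in> G" "leading_monomial ord1 g m'" "m = c + m'"
      "\<And>a. a \<in> Poly_Mapping.keys g \<Longrightarrow>
        \<exists>b\<in>Poly_Mapping.keys h. monomial_degree (c + a) \<le> monomial_degree b"
      using \<open>h \<in> V\<close> \<open>leading_monomial ord1 h m\<close> G unfolding standard_basis_def V_def by blast
    moreover have "c + a \<in> M" if "a \<in> Poly_Mapping.keys g" for a
      using g(4)[OF that] \<open>h \<in> V\<close> le_trans unfolding V_def M_def by blast
    ultimately show ?thesis
      using lm by blast
  qed
  have "\<exists>h\<in>V. leading_monomial ord1 h m"
  proof (rule leading_monomials_eq_of_subset[OF ord, of V M f])
    show "mpoly.subspace V"
      unfolding V_def by (rule is_ideal_subspace[OF I])
    show "finite M"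
      by (simp add: M_def finite_monomial_degree_le)
    show "f \<in> V"
      using f(1) by (auto simp: V_def M_def)
    fix h m
    assume "h \<in> V" "leading_monomial ord1 h m"
    then obtain g c m' where g: "g \<in> G" "leading_monomial ord2 g m'" "m = c + m'"
      "\<forall>a\<in>Poly_Mapping.keys g. c + a \<in> M"
      using std by blast
    have "Poly_Mapping.single c 1 * g \<in> V"
      using g I \<open>G \<subseteq> I\<close> unfolding V_def is_ideal_iff by (auto simp: keys_single_mult)
    then show "\<exists>g\<in>V. leading_monomial ord2 g m"
      using leading_monomial_single_mult[OF ord(2) g(2), of 1 c] g(3) by auto
  qed (use f(2) in \<open>auto simp: V_def\<close>)
  then obtain h where "h \<in> V" "leading_monomial ord1 h m"
    by blast
  from std[OF this] show "\<exists>g\<in>G. \<exists>c m'. leading_monomial ord2 g m' \<and> m = c + m' \<and>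
      (\<forall>a\<in>Poly_Mapping.keys g. \<exists>b\<in>Poly_Mapping.keys f. monomial_degree (c + a) \<le> monomial_degree b)"
    by (simp add: M_def)
qed

section \<open>Leading ideals from standard bases\<close>

text \<open>One reduction step splits the leading part of \<open>f\<close> into the class parts of
  \<open>f - ?h\<close> and of \<open>?h\<close> at the leading monomial \<open>m\<close>. The
  latter is a multiple of the leading part of some \<open>g\<close> in \<open>G\<close>; the former
  is covered by induction, which terminates because reduction stays within a degree bound.\<close>

lemma leading_ideal_standard_basis:
  fixes I :: "('n::finite, 'k::field) mpoly set"
  assumes lt: "monomial_preorder lt" and I: "is_ideal I"
    and G: "standard_basis (tie_break lt) I G"
  shows "leading_ideal lt I = leading_ideal lt G"
proof
  have "G \<subseteq> I"
    using G by (simp add: standard_basis_def)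
  then show "leading_ideal lt G \<subseteq> leading_ideal lt I"
    unfolding leading_ideal_def by (intro module.span_mono[OF module_times] image_mono)
  note ord = monomial_order_tie_break[OF lt]
  have max: "\<not> lt m b" if "leading_monomial (tie_break lt) f m" "b \<in> Poly_Mapping.keys f"
    for f :: "('n, 'k) mpoly" and m b
    using that monomial_order_asym[OF ord, of b m] monomial_preorder_irrefl[OF lt]
    by (auto simp: leading_monomial_def tie_break_def)
  have "leading_part lt f0 \<in> leading_ideal lt G" if "f0 \<in> I" for f0
  proof -
    define M where "M = (\<Union>b\<in>Poly_Mapping.keys f0. {a :: nat ^ 'n. monomial_degree a \<le> monomial_degree b})"
    define V where "V = {f \<in> I. Poly_Mapping.keys f \<subseteq> M}"
    have M_down: "a \<in> M" if "b \<in> M" "monomial_degree a \<le> monomial_degree b" for a b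
      using that le_trans unfolding M_def by blast
    show ?thesis
    proof (rule leading_monomial_induct[where P = "\<lambda>f. leading_part lt f \<in> leading_ideal lt G", OF ord])
      show "finite M"
        by (simp add: M_def finite_monomial_degree_le)
      show "f0 \<in> V"
        using that by (auto simp: V_def M_def)
      show "\<And>f. f \<in> V \<Longrightarrow> Poly_Mapping.keys f \<subseteq> M"
        by (auto simp: V_def)
      show "leading_part lt 0 \<in> leading_ideal lt G"
        unfolding leading_ideal_def leading_part_zero by (rule module.span_zero[OF module_times])
    next
      fix f m
      assume f: "f \<in> V" "leading_monomial (tie_break lt) f m"
        and IH: "\<And>f'. f' \<in> V \<Longrightarrow> (\<And>b. b \<in> Poly_Mapping.keys f' \<Longrightarrow> tie_break lt b m) \<Longrightarrow>
          leading_part lt f' \<in> leading_ideal lt G"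
      then obtain g c m' where g: "g \<in> G" "leading_monomial (tie_break lt) g m'" "m = c + m'"
        "\<And>a. a \<in> Poly_Mapping.keys g \<Longrightarrow>
          \<exists>b\<in>Poly_Mapping.keys f. monomial_degree (c + a) \<le> monomial_degree b"
        using G unfolding standard_basis_def V_def by blast
      define k where "k = Poly_Mapping.lookup f m / Poly_Mapping.lookup g m'"
      have nz: "Poly_Mapping.lookup f m \<noteq> 0" "Poly_Mapping.lookup g m' \<noteq> 0"
        using f(2) g(2) by (auto simp: leading_monomial_def in_keys_iff)
      then have "k \<noteq> 0"
        by (simp add: k_def)
      let ?h = "Poly_Mapping.single c k * g"
      have h: "leading_monomial (tie_break lt) ?h m"
        using leading_monomial_single_mult[OF ord g(2) \<open>k \<noteq> 0\<close>] g(3) by simp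
      have "Poly_Mapping.keys ?h \<subseteq> M"
        using g(4) f(1) M_down \<open>k \<noteq> 0\<close> by (fastforce simp: keys_single_mult V_def)
      then have "Poly_Mapping.keys (f - ?h) \<subseteq> M"
        using f(1) keys_diff[of f ?h] by (auto simp: V_def)
      moreover have "f - ?h \<in> I"
        using I f(1) g(1) \<open>G \<subseteq> I\<close> unfolding V_def
        by (intro module.subspace_diff[OF module_times] module.subspace_scale[OF module_times]) auto
      ultimately have V: "f - ?h \<in> V"
        by (simp add: V_def)
      have below: "tie_break lt b m" if "b \<in> Poly_Mapping.keys (f - ?h)" for b
        using cancel_leading_monomial[OF f(2) h _ that] nz g(3)
        by (simp add: lookup_single_mult_add k_def)
      have "class_part lt m (f - ?h) \<in> leading_ideal lt G"
      \<comment> \<open>Subtraction may leave monomials equivalent to \<open>m\<close>. Such a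
        \<open>b\<close> is maximal in \<open>f - ?h\<close>, so the class part is the leading part
        of \<open>f - ?h\<close>; if there is none, the class part is zero.\<close>
      proof (cases "\<exists>b\<in>Poly_Mapping.keys (f - ?h). incomparable lt m b")
        case True
        then obtain b where b: "b \<in> Poly_Mapping.keys (f - ?h)" "incomparable lt m b"
          by blast
        have "\<not> lt m a" if "a \<in> Poly_Mapping.keys (f - ?h)" for a
          using below[OF that] monomial_order_asym[OF ord, of a m] by (auto simp: tie_break_def)
        then have "leading_part lt (f - ?h) = class_part lt b (f - ?h)"
          using monomial_preorder_incomparable_less[OF lt b(2)] b(1)
          by (intro leading_part_eq_class_part[OF lt]) auto
        also have "\<dots> = class_part lt m (f - ?h)"
        proof -
          have "incomparable lt b a \<longleftrightarrow> incomparable lt m a" for a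
            using monomial_preorder_incomparable_trans[OF lt b(2), of a]
              monomial_preorder_incomparable_trans[OF lt incomparable_sym[OF b(2)], of a] by blast
          then show ?thesis
            by (simp add: class_part_def)
        qed
        finally show ?thesis
          using IH[OF V below] by simp
      next
        case False
        then have "class_part lt m (f - ?h) = 0"
          unfolding class_part_def by (intro sum.neutral) auto
        then show ?thesis
          unfolding leading_ideal_def by (simp add: module.span_zero[OF module_times])
      qed
      moreover have "class_part lt m ?h \<in> leading_ideal lt G"
      proof -
        have "class_part lt m ?h = Poly_Mapping.single c k * leading_part lt g"
          using class_part_single_mult[OF lt \<open>k \<noteq> 0\<close>, of c m' g]
            leading_part_eq_class_part[OF lt, of m' g] max[OF g(2)] g(2,3)
          by (simp add: leading_monomial_def)
        then show ?thesis
          unfolding leading_ideal_def using g(1)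
          by (simp add: module.span_scale[OF module_times] module.span_base[OF module_times])
      qed
      ultimately have "class_part lt m (f - ?h) + class_part lt m ?h \<in> leading_ideal lt G"
        unfolding leading_ideal_def by (rule module.span_add[OF module_times])
      also have "class_part lt m (f - ?h) + class_part lt m ?h = leading_part lt f"
        using leading_part_eq_class_part[OF lt, of m f] max[OF f(2)] f(2)
        by (simp add: leading_monomial_def flip: class_part_add)
      finally show "leading_part lt f \<in> leading_ideal lt G" .
    qed
  qed
  then show "leading_ideal lt I \<subseteq> leading_ideal lt G"
    unfolding leading_ideal_def[of lt I]
    by (intro module.span_minimal[OF module_times])
      (auto simp: leading_ideal_def intro: module.subspace_span[OF module_times])
qed

text \<open>The leading monomial and the leading part of each \<open>g\<close> depend only on
  comparisons among its own monomials. Hence \<open>G\<close> is a standard basis for both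
  refinements and yields the same generators.\<close>

lemma leading_ideal_eq_of_agree:
  fixes I :: "('n::finite, 'k::field) mpoly set"
  assumes lt: "monomial_preorder lt1" "monomial_preorder lt2" and I: "is_ideal I"
    and G: "standard_basis (tie_break lt1) I G"
    and agree: "\<And>g a b. g \<in> G \<Longrightarrow> a \<in> Poly_Mapping.keys g \<Longrightarrow> b \<in> Poly_Mapping.keys g \<Longrightarrow>
      lt1 a b \<longleftrightarrow> lt2 a b"
  shows "leading_ideal lt1 I = leading_ideal lt2 I"
proof -
  have "leading_monomial (tie_break lt1) g m \<longleftrightarrow> leading_monomial (tie_break lt2) g m"
    if "g \<in> G" for g m
    using agree[OF that]
    by (auto simp: leading_monomial_def tie_break_def incomparable_def)
  then have "standard_basis (tie_break lt2) I G"
    by (intro standard_basis_change_order[OF lt[THEN monomial_order_tie_break] I G])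
  then have "leading_ideal lt2 I = leading_ideal lt2 G"
    by (rule leading_ideal_standard_basis[OF lt(2) I])
  moreover have "leading_part lt1 g = leading_part lt2 g" if "g \<in> G" for g
    unfolding leading_part_def using agree[OF that] by (intro sum.cong) auto
  then have "leading_ideal lt1 G = leading_ideal lt2 G"
    unfolding leading_ideal_def by (simp cong: image_cong)
  ultimately show ?thesis
    using leading_ideal_standard_basis[OF lt(1) I G] by simp
qed

theorem theorem3p2:
  fixes lt :: "nat ^ 'n::finite \<Rightarrow> nat ^ 'n \<Rightarrow> bool"
    and r :: nat
    and I :: "nat \<Rightarrow> ('n, 'k::field) mpoly set"
  assumes "monomial_preorder lt"
    and "\<And>i. i \<in> {1..r} \<Longrightarrow> is_ideal (I i)"
  shows "\<exists>w :: int ^ 'n. \<forall>i \<in> {1..r}.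
           leading_ideal lt (I i) =
           leading_ideal (weight_less (\<chi> j. real_of_int (w $ j))) (I i)"
proof -
  define G where "G i = (SOME G. finite G \<and> standard_basis (tie_break lt) (I i) G)" for i
  have G: "finite (G i) \<and> standard_basis (tie_break lt) (I i) (G i)" for i
    unfolding G_def
    by (rule someI_ex) (rule exists_finite_standard_basis[OF monomial_order_tie_break[OF assms(1)]])
  \<comment> \<open>Pooling the monomials of all these bases lets a single weight serve all the
    ideals at once.\<close>
  define M where "M = (\<Union>i\<in>{1..r}. \<Union>g\<in>G i. Poly_Mapping.keys g)"
  have "finite M"
    using G by (simp add: M_def)
  then obtain w :: "int ^ 'n" where
    w: "\<forall>a\<in>M. \<forall>b\<in>M. weight_less (\<chi> j. real_of_int (w $ j)) a b \<longleftrightarrow> lt a b"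
    using monomial_preorder_exists_weight[OF assms(1)] by blast
  have "leading_ideal lt (I i) = leading_ideal (weight_less (\<chi> j. real_of_int (w $ j))) (I i)"
    if "i \<in> {1..r}" for i
  proof (rule leading_ideal_eq_of_agree[OF assms(1) monomial_preorder_weight_less assms(2)[OF that]])
    show "standard_basis (tie_break lt) (I i) (G i)"
      using G by blast
    fix g a b
    assume "g \<in> G i" "a \<in> Poly_Mapping.keys g" "b \<in> Poly_Mapping.keys g"
    with that have "a \<in> M" "b \<in> M"
      unfolding M_def by blast+
    with w show "lt a b \<longleftrightarrow> weight_less (\<chi> j. real_of_int (w $ j)) a b"
      by blast
  qed
  then show ?thesis
    by blast
qed

end
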